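(* Let $S$ be a nonempty (possibly infinite) set of positive integers, let $\sigma$ be a positive integer, and let $n\ge 0$ be an integer. If $\sigma\not\in S$, then $$A_{n,S\cup \{\sigma\}}=\sum_{i=0}^{\left \lfloor{n/\sigma}\right \rfloor } \frac{n!}{i!\,(n-\sigma i)!\,\sigma^i} A_{n-\sigma i,S}. $$ If $\sigma \in S$, then $$A_{n,S\setminus\{\sigma\}}=\sum_{i=0}^{\left \lfloor{n/\sigma}\right \rfloor } \frac{n!\, (-1)^i}{i!\,(n-\sigma i)!\,\sigma^i} A_{n-\sigma i,S}. $$
   Context: For a set $S$ of positive integers and an integer $n\ge 0$, $A_{n,S}$ is the number of permutations of $n$ labeled elements all of whose cycle lengths belong to $S$ (fixed points being cycles of length 1), with $A_{0,S}=1$. The same definition is used if the set is empty (so $A_{0,\emptyset}=1$ and $A_{n,\emptyset}=0$ for $n\ge1$). *)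

theory Defs
  imports Complex_Main "HOL-Combinatorics.Combinatorics"
begin

text \<open>The cycle of a permutation \<open>p\<close> through \<open>x\<close> is \<open>orbit p x\<close>, which contains \<open>x\<close> itself, so
  that a fixed point has an orbit of size 1. Points outside \<open>X\<close> are fixed by \<open>p permutes X\<close>
  but are not elements being permuted, so only orbits of points of \<open>X\<close> count.\<close>

definition cycle_lengths :: "('a \<Rightarrow> 'a) \<Rightarrow> 'a set \<Rightarrow> nat set" where
  "cycle_lengths p X = {card (orbit p x) | x. x \<in> X}"

definition A :: "nat \<Rightarrow> nat set \<Rightarrow> nat" where
  "A n S = card {p. p permutes {1..n} \<and> cycle_lengths p {1..n} \<subseteq> S}"

lemma A_0 [simp]: "A 0 S = 1"
  by (simp add: A_def cycle_lengths_def)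

lemma A_empty:
  assumes "n \<ge> 1"
  shows "A n {} = 0"
proof -
  from assms have "1 \<in> {1..n}" by simp
  then have "cycle_lengths p {1..n} \<noteq> {}" for p
    unfolding cycle_lengths_def by blast
  then show ?thesis by (simp add: A_def)
qed

end

theory Submission
  imports Defs "HOL-Computational_Algebra.Formal_Power_Series"
begin

text \<open>
  In a permutation, the cycle through a chosen point \<open>a\<close> is a list of distinct points starting with
  \<open>a\<close>, and removing it leaves a permutation of the other points. Hence the exponential generating
  function \<open>F\<close> of \<open>A n S\<close> is the solution of \<open>F' = (\<Sum>k\<in>S. x^(k - 1)) * F\<close> with \<open>F(0) = 1\<close>.
  Multiplying \<open>F\<close> by \<open>exp (c * x^\<sigma> / \<sigma>)\<close> adds \<open>c * x^(\<sigma> - 1)\<close> to the factor in this equation, so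
  \<open>c = 1\<close> adjoins \<open>\<sigma>\<close> to \<open>S\<close> and \<open>c = -1\<close> removes it.
\<close>

section \<open>Splitting off the cycle through a point\<close>

text \<open>The ground set is arbitrary because removing a cycle from \<open>{1..n}\<close> leaves a
  set that is no longer an initial segment.\<close>

definition perms_with :: "nat set \<Rightarrow> 'a set \<Rightarrow> ('a \<Rightarrow> 'a) set" where
  "perms_with S X = {p. p permutes X \<and> cycle_lengths p X \<subseteq> S}"

lemma finite_perms_with: "finite X \<Longrightarrow> finite (perms_with S X)"
  unfolding perms_with_def using finite_permutations by (rule finite_subset[rotated]) auto

lemma perms_with_empty: "perms_with S {} = {id}"
  by (auto simp: perms_with_def cycle_lengths_def)

text \<open>Applying the cycle to every entry of its list rotates the list by one place, so the head
  of the \<open>n\<close>-fold rotation is the \<open>n\<close>-th iterate of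
  \<open>a\<close>.\<close>

lemma cycle_of_list_funpow:
  assumes "distinct (a # xs)"
  shows "(cycle_of_list (a # xs) ^^ n) a = (a # xs) ! (n mod Suc (length xs))"
proof -
  have "(cycle_of_list (a # xs) ^^ n) a = map (cycle_of_list (a # xs) ^^ n) (a # xs) ! 0"
    by simp
  also have "\<dots> = rotate n (a # xs) ! 0"
    by (simp only: cyclic_rotation[OF assms])
  also have "\<dots> = (a # xs) ! (n mod Suc (length xs))"
    by (subst nth_rotate) auto
  finally show ?thesis .
qed

context
  fixes a :: 'a and xs :: "'a list" and R :: "'a set" and q :: "'a \<Rightarrow> 'a"
  assumes dist: "distinct (a # xs)" and disj: "set (a # xs) \<inter> R = {}"
    and q: "q permutes R" and fin: "finite R"
begin

lemma cycle_comp_on_cycle: "x \<in> set (a # xs) \<Longrightarrow> (cycle_of_list (a # xs) \<circ> q) x = cycle_of_list (a # xs) x"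
proof -
  assume "x \<in> set (a # xs)"
  then have "x \<notin> R"
    using disj by blast
  then show ?thesis
    by (simp add: permutes_not_in[OF q])
qed

lemma cycle_comp_on_rest: "x \<in> R \<Longrightarrow> (cycle_of_list (a # xs) \<circ> q) x = q x"
proof -
  assume "x \<in> R"
  then have "q x \<notin> set (a # xs)"
    using disj permutes_in_image[OF q] by blast
  then show ?thesis
    by (simp add: id_outside_supp del: cycle_of_list.simps)
qed

lemma cycle_comp_permutes: "(cycle_of_list (a # xs) \<circ> q) permutes (set (a # xs) \<union> R)"
  by (intro permutes_compose permutes_subset[OF q] permutes_subset[OF cycle_permutes]) auto

text \<open>The iterates of \<open>a\<close> under the cycle stay among its entries, all of which
  \<open>q\<close> fixes, so the factor \<open>q\<close> has no effect on them.\<close>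

lemma cycle_comp_funpow:
  "((cycle_of_list (a # xs) \<circ> q) ^^ n) a = (a # xs) ! (n mod Suc (length xs))"
proof -
  have "((cycle_of_list (a # xs) \<circ> q) ^^ n) a = (cycle_of_list (a # xs) ^^ n) a"
  proof (induction n)
    case (Suc n)
    have "(cycle_of_list (a # xs) ^^ n) a \<in> set (a # xs)"
      unfolding cycle_of_list_funpow[OF dist] by (rule nth_mem) simp
    with Suc show ?case
      using cycle_comp_on_cycle by (simp del: cycle_of_list.simps)
  qed simp
  then show ?thesis
    by (simp only: cycle_of_list_funpow[OF dist])
qed

lemma cycle_comp_orbit:
  assumes "x \<in> set (a # xs)"
  shows "orbit (cycle_of_list (a # xs) \<circ> q) x = set (a # xs)"
proof -
  let ?p = "cycle_of_list (a # xs) \<circ> q"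
  have perm: "permutation ?p"
    using cycle_comp_permutes fin unfolding permutation_permutes by blast
  have "orbit ?p a = {(a # xs) ! (n mod Suc (length xs)) |n. True}"
    by (simp only: orbit_altdef_permutation[OF perm] cycle_comp_funpow)
  also have "\<dots> = set (a # xs)"
    unfolding set_conv_nth
  proof (intro equalityI subsetI)
    fix y assume "y \<in> {(a # xs) ! i |i. i < length (a # xs)}"
    then obtain i where "y = (a # xs) ! i" "i < Suc (length xs)"
      by auto
    then have "y = (a # xs) ! (i mod Suc (length xs))"
      by simp
    then show "y \<in> {(a # xs) ! (n mod Suc (length xs)) |n. True}"
      by blast
  qed fastforce
  \<comment> \<open>All points of a cycle have the same orbit, so the computation for
    \<open>a\<close> settles every entry \<open>x\<close>.\<close>
  finally show ?thesis
    using orbit_cyclic_eq3[OF cyclic_on_orbit'[OF perm, of a]] assms by simp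
qed

lemma cycle_comp_orbit_rest:
  assumes "x \<in> R"
  shows "orbit (cycle_of_list (a # xs) \<circ> q) x = orbit q x"
  by (rule orbit_cong0[OF assms])
     (use cycle_comp_on_rest permutes_in_image[OF q] in auto)

text \<open>The two factors live on disjoint sets, so the composite has the cycles of
  \<open>q\<close> and one further cycle, of length \<open>Suc (length xs)\<close>.\<close>

lemma cycle_comp_in_perms_with_iff:
  "cycle_of_list (a # xs) \<circ> q \<in> perms_with S (set (a # xs) \<union> R)
     \<longleftrightarrow> Suc (length xs) \<in> S \<and> q \<in> perms_with S R"
proof -
  have card: "card (set (a # xs)) = Suc (length xs)"
    using dist distinct_card by fastforce
  have "cycle_lengths (cycle_of_list (a # xs) \<circ> q) (set (a # xs) \<union> R)
          = insert (Suc (length xs)) (cycle_lengths q R)" (is "?L = ?R")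
  proof -
    have "?L = (\<lambda>x. card (orbit (cycle_of_list (a # xs) \<circ> q) x)) ` set (a # xs)
               \<union> (\<lambda>x. card (orbit (cycle_of_list (a # xs) \<circ> q) x)) ` R"
      unfolding cycle_lengths_def by blast
    also have "(\<lambda>x. card (orbit (cycle_of_list (a # xs) \<circ> q) x)) ` set (a # xs)
                 = (\<lambda>x. Suc (length xs)) ` set (a # xs)"
      by (intro image_cong refl) (simp only: cycle_comp_orbit card)
    also have "\<dots> = {Suc (length xs)}"
      by auto
    also have "(\<lambda>x. card (orbit (cycle_of_list (a # xs) \<circ> q) x)) ` R = cycle_lengths q R"
      unfolding cycle_lengths_def using cycle_comp_orbit_rest by (auto simp del: cycle_of_list.simps)
    finally show ?thesis
      unfolding insert_is_Un[symmetric, of _ "cycle_lengths q R"] .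
  qed
  then show ?thesis
    using cycle_comp_permutes q unfolding perms_with_def mem_Collect_eq by simp
qed

end

text \<open>The list is the orbit of \<open>a\<close> in the order in which \<open>p\<close> visits
  it; \<open>q\<close> is \<open>p\<close> with that orbit made fixed.\<close>

lemma perms_with_split_cycle:
  assumes p: "p permutes insert a X" and fin: "finite X" and a: "a \<notin> X"
  obtains xs q where "distinct xs" "set xs \<subseteq> X" "q permutes (X - set xs)"
    "p = cycle_of_list (a # xs) \<circ> q"
proof -
  have perm: "permutation p"
    using p fin unfolding permutation_permutes by blast
  let ?cs = "support p a"
  have cs_set: "set ?cs = orbit p a"
    unfolding support_set[OF perm] orbit_altdef_permutation[OF perm] by auto
  have pos: "least_power p a > 0"
    by (rule least_power_of_permutation(2)[OF perm])
  \<comment> \<open>\<open>support p a\<close> lists the iterates of \<open>a\<close> with exponents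
    from 0 up to, but excluding, \<open>least_power p a\<close>; as this bound is positive, the list
    starts with \<open>a\<close> itself.\<close>
  then have "?cs = a # tl ?cs"
    by (simp add: upt_conv_Cons)
  then obtain xs where cs: "?cs = a # xs" ..
  have dist: "distinct (a # xs)"
    using cycle_of_permutation[OF perm, of a] by (simp only: cs)
  have sub: "set (a # xs) \<subseteq> insert a X"
    using permutes_orbit_subset[OF p, of a] cs_set by (simp add: cs)
  define q where "q = perm_restrict p (insert a X - orbit p a)"
  have R: "insert a X - orbit p a = X - set xs"
    using cs_set a unfolding cs by auto
  have q: "q permutes (X - set xs)"
    unfolding q_def R[symmetric] using fin
    by (intro perm_restrict_diff_cyclic p cyclic_on_orbit[OF p]) simp
  have "p = cycle_of_list (a # xs) \<circ> q"
  proof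
    fix x
    consider "x \<in> set (a # xs)" | "x \<in> X - set xs" "x \<notin> set (a # xs)" | "x \<notin> insert a X" "x \<notin> set (a # xs)"
      using a by auto
    then show "p x = (cycle_of_list (a # xs) \<circ> q) x"
    proof cases
      case 1
      then have "p x = cycle_of_list (a # xs) x"
        using cycle_restrict[OF perm, of x a] by (simp only: cs)
      moreover have "q x = x"
        using 1 a permutes_not_in[OF q, of x] by auto
      ultimately show ?thesis
        by (simp del: cycle_of_list.simps)
    next
      case 2
      then have qx: "q x = p x"
        unfolding q_def R by (simp add: perm_restrict_simps)
      have "q x \<in> X - set xs"
        using 2 permutes_in_image[OF q] by blast
      then have "q x \<notin> set (a # xs)"
        using a by auto
      then show ?thesis
        using qx by (simp add: id_outside_supp del: cycle_of_list.simps)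
    next
      case 3
      then show ?thesis
        using permutes_not_in[OF q, of x] permutes_not_in[OF p, of x]
        by (simp add: id_outside_supp del: cycle_of_list.simps)
    qed
  qed
  moreover have "set xs \<subseteq> X"
    using sub dist by auto
  ultimately show thesis
    using that dist q by auto
qed

text \<open>A cycle can be written as a list starting at any of its points; fixing \<open>a\<close>
  as the head removes this ambiguity and makes the decomposition unique.\<close>

lemma bij_betw_perms_with_insert:
  assumes fin: "finite X" and a: "a \<notin> X"
  shows "bij_betw (\<lambda>(xs, q). cycle_of_list (a # xs) \<circ> q)
           (SIGMA xs:{xs. distinct xs \<and> set xs \<subseteq> X \<and> Suc (length xs) \<in> S}. perms_with S (X - set xs))
           (perms_with S (insert a X))"
    (is "bij_betw ?f ?D ?P")
proof (rule bij_betw_imageI)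
  have D: "distinct (a # xs)" "set (a # xs) \<inter> (X - set xs) = {}"
      "set (a # xs) \<union> (X - set xs) = insert a X" if "distinct xs" "set xs \<subseteq> X" for xs
    using that a by auto
  have fin': "finite (X - set xs)" for xs
    using fin by simp
  show "inj_on ?f ?D"
  proof (rule inj_onI, clarify)
    fix xs q ys r
    assume xs: "distinct xs" "set xs \<subseteq> X" and ys: "distinct ys" "set ys \<subseteq> X"
      and "q \<in> perms_with S (X - set xs)" "r \<in> perms_with S (X - set ys)"
      and eq: "cycle_of_list (a # xs) \<circ> q = cycle_of_list (a # ys) \<circ> r"
    then have q: "q permutes (X - set xs)" and r: "r permutes (X - set ys)"
      by (simp_all add: perms_with_def)
    note qs = D(1,2)[OF xs] q fin' and rs = D(1,2)[OF ys] r fin'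
    \<comment> \<open>Both sides are the orbit of \<open>a\<close> under the common composite. Once
      the lengths agree, the entries agree as well, being the iterates of \<open>a\<close>.\<close>
    have "set (a # xs) = set (a # ys)"
      using cycle_comp_orbit[OF qs, of a] cycle_comp_orbit[OF rs, of a] eq by simp
    then have len: "length xs = length ys"
      using distinct_card[OF D(1)[OF xs]] distinct_card[OF D(1)[OF ys]] by simp
    have "(a # xs) ! i = (a # ys) ! i" if "i < length (a # xs)" for i
      using cycle_comp_funpow[OF qs, of i] cycle_comp_funpow[OF rs, of i] eq that len
      by (simp del: cycle_of_list.simps)
    then have "a # xs = a # ys"
      using len by (intro nth_equalityI) auto
    then have "xs = ys"
      by simp
    moreover have "q x = r x" for x
    proof (cases "x \<in> X - set xs")
      case True
      then have "x \<in> X - set ys"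
        by (simp only: \<open>xs = ys\<close>)
      then have "(cycle_of_list (a # ys) \<circ> r) x = r x"
        by (rule cycle_comp_on_rest[OF rs])
      then show ?thesis
        using cycle_comp_on_rest[OF qs True] by (simp only: eq)
    next
      case False
      then show ?thesis
        using permutes_not_in[OF q] permutes_not_in[OF r] \<open>xs = ys\<close> by simp
    qed
    ultimately show "xs = ys \<and> q = r"
      by auto
  qed
  show "?f ` ?D = ?P"
  proof (intro equalityI subsetI)
    fix p assume "p \<in> ?f ` ?D"
    then obtain xs q where xs: "distinct xs" "set xs \<subseteq> X" and "Suc (length xs) \<in> S"
        and q: "q \<in> perms_with S (X - set xs)" and p: "p = cycle_of_list (a # xs) \<circ> q"
      by auto
    moreover have "q permutes (X - set xs)"
      using q by (simp add: perms_with_def)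
    ultimately show "p \<in> ?P"
      using cycle_comp_in_perms_with_iff[OF D(1,2)[OF xs] _ fin', of q S]
      unfolding D(3)[OF xs] by simp
  next
    fix p assume p: "p \<in> ?P"
    then have "p permutes insert a X"
      by (simp add: perms_with_def)
    then obtain xs q where xs: "distinct xs" "set xs \<subseteq> X" and q: "q permutes (X - set xs)"
        and p_eq: "p = cycle_of_list (a # xs) \<circ> q"
      using perms_with_split_cycle[OF _ fin a] by blast
    then have "Suc (length xs) \<in> S \<and> q \<in> perms_with S (X - set xs)"
      using cycle_comp_in_perms_with_iff[OF D(1,2)[OF xs] q fin', of S] p
      unfolding D(3)[OF xs] by simp
    then have "(xs, q) \<in> ?D"
      using xs by simp
    then show "p \<in> ?f ` ?D"
      by (rule rev_image_eqI) (simp only: p_eq case_prod_conv)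
  qed
qed

section \<open>The exponential generating function\<close>

unbundle fps_syntax

text \<open>This is the derivative of the sum of \<open>x^k / k\<close> over the positive
  \<open>k\<close> in \<open>S\<close>, the exponential generating function of single cycles with
  length in \<open>S\<close>.\<close>

definition cycle_fps :: "nat set \<Rightarrow> real fps" where
  "cycle_fps S = Abs_fps (\<lambda>n. of_bool (Suc n \<in> S))"

lemma card_perms_with_insert:
  assumes fin: "finite X" and a: "a \<notin> X"
  shows "card (perms_with S (insert a X))
    = (\<Sum>xs | distinct xs \<and> set xs \<subseteq> X \<and> Suc (length xs) \<in> S. card (perms_with S (X - set xs)))"
proof -
  have "finite {xs. distinct xs \<and> set xs \<subseteq> X \<and> Suc (length xs) \<in> S}"
    using finite_subset_distinct[OF fin] by (rule finite_subset[rotated]) auto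
  then show ?thesis
    using bij_betw_same_card[OF bij_betw_perms_with_insert[OF assms, of S]]
    by (subst (asm) card_SigmaI) (auto simp: fin finite_perms_with)
qed

lemma card_distinct_lists:
  assumes "finite X" "k \<le> card X"
  shows "real (card {xs. length xs = k \<and> distinct xs \<and> set xs \<subseteq> X}) = fact (card X) / fact (card X - k)"
proof -
  have "fact (card X) = (fact (card X - k) * \<Prod>{card X - k + 1..card X} :: nat)"
    using fact_eq_fact_times[of "card X - k" "card X"] by simp
  then have "(fact (card X) :: real) = fact (card X - k) * real (\<Prod>{card X - k + 1..card X})"
    by (metis of_nat_fact of_nat_mult)
  then show ?thesis
    unfolding card_lists_distinct_length_eq[OF assms] by (simp add: field_simps)
qed

text \<open>Strong induction on the size of \<open>X\<close>: the recurrence obtained by removing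
  the cycle through one point is the differential equation read coefficientwise.\<close>

lemma card_perms_with:
  assumes F0: "F $ 0 = 1" and F': "fps_deriv F = cycle_fps S * F" and "finite X"
  shows "real (card (perms_with S X)) = fact (card X) * F $ card X"
  using \<open>finite X\<close>
proof (induction "card X" arbitrary: X rule: less_induct)
  case less
  show ?case
  proof (cases "X = {}")
    case True
    then show ?thesis
      by (simp add: perms_with_empty F0)
  next
    case False
    then obtain a Y where X: "X = insert a Y" and a: "a \<notin> Y"
      by (meson Set.set_insert all_not_in_conv)
    then have fin: "finite Y" and card: "card X = Suc (card Y)"
      using less.prems by auto
    define n where "n = card Y"
    define L where "L k = {xs. length xs = k \<and> distinct xs \<and> set xs \<subseteq> Y}" for k
    \<comment> \<open>Here \<open>k\<close> counts the points of the cycle other than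
      \<open>a\<close>, hence \<open>Suc k\<close> in the condition.\<close>
    define K where "K = {k. k \<le> n \<and> Suc k \<in> S}"
    have finK: "finite K"
      unfolding K_def by simp
    have finL: "finite (L k)" for k
      using finite_subset_distinct[OF fin] unfolding L_def by (rule finite_subset[rotated]) auto
    have lists: "{xs. distinct xs \<and> set xs \<subseteq> Y \<and> Suc (length xs) \<in> S} = (\<Union>k\<in>K. L k)"
      unfolding L_def K_def n_def using card_mono[OF fin] by (fastforce simp flip: distinct_card)
    have IH: "real (card (perms_with S (Y - set xs))) = fact (n - k) * F $ (n - k)"
      if "xs \<in> L k" for xs k
    proof -
      have "card (Y - set xs) = n - k"
        using that fin unfolding L_def n_def by (auto simp: card_Diff_subset distinct_card)
      then show ?thesis
        using less.hyps[of "Y - set xs"] fin card n_def by simp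
    qed
    have "real (card (perms_with S X))
        = (\<Sum>xs\<in>(\<Union>k\<in>K. L k). real (card (perms_with S (Y - set xs))))"
      unfolding X card_perms_with_insert[OF fin a] lists by simp
    also have "\<dots> = (\<Sum>k\<in>K. \<Sum>xs\<in>L k. real (card (perms_with S (Y - set xs))))"
      by (rule sum.UNION_disjoint) (use finK finL in \<open>auto simp: L_def\<close>)
    also have "\<dots> = (\<Sum>k\<in>K. real (card (L k)) * (fact (n - k) * F $ (n - k)))"
      by (simp add: IH cong: sum.cong)
    \<comment> \<open>There are \<open>fact n / fact (n - k)\<close> lists in \<open>L k\<close>,
      and the denominator cancels against the factorial from the induction hypothesis.\<close>
    also have "\<dots> = (\<Sum>k\<in>K. fact n * F $ (n - k))"
      unfolding L_def n_def K_def by (intro sum.cong refl) (simp add: card_distinct_lists[OF fin])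
    also have "\<dots> = (\<Sum>k=0..n. of_bool (Suc k \<in> S) * (fact n * F $ (n - k)))"
      unfolding K_def by (intro sum.mono_neutral_cong_left) auto
    also have "\<dots> = fact n * (cycle_fps S * F) $ n"
      unfolding fps_mult_nth cycle_fps_def fps_nth_Abs_fps sum_distrib_left
      by (intro sum.cong refl mult.left_commute)
    \<comment> \<open>Coefficient \<open>n\<close> of \<open>fps_deriv F\<close> is
      \<open>Suc n\<close> times coefficient \<open>Suc n\<close> of \<open>F\<close>, and this
      factor turns \<open>fact n\<close> into \<open>fact (Suc n)\<close>.\<close>
    also have "\<dots> = fact (card X) * F $ card X"
      unfolding F'[symmetric] card n_def by simp
    finally show ?thesis .
  qed
qed

lemma A_eq_fps_nth:
  assumes "F $ 0 = 1" and "fps_deriv F = cycle_fps S * F"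
  shows "real (A n S) = fact n * F $ n"
  using card_perms_with[OF assms, of "{1..n}"] by (simp add: A_def perms_with_def)

text \<open>The linear equation is solved by the exponential of the antiderivative of
  \<open>cycle_fps S\<close> with constant term 0.\<close>

lemma cycle_fps_egf_exists:
  obtains F :: "real fps" where "F $ 0 = 1" "fps_deriv F = cycle_fps S * F"
proof
  let ?F = "fps_exp 1 oo fps_integral0 (cycle_fps S)"
  show "?F $ 0 = 1"
    by simp
  show "fps_deriv ?F = cycle_fps S * ?F"
    by (simp add: fps_compose_deriv fps_deriv_fps_integral mult.commute)
qed

section \<open>Changing the set at one cycle length\<close>

lemma fps_deriv_exp_power:
  assumes "\<sigma> > 0"
  shows "fps_deriv (fps_exp (c / real \<sigma>) oo fps_X ^ \<sigma>)
    = fps_const c * fps_X ^ (\<sigma> - 1) * (fps_exp (c / real \<sigma>) oo fps_X ^ \<sigma>)"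
proof -
  have X0: "(fps_X ^ \<sigma> :: real fps) $ 0 = 0"
    using assms by simp
  \<comment> \<open>Differentiating \<open>x^\<sigma>\<close> brings down a factor
    \<open>\<sigma>\<close>, which cancels the denominator of the exponent.\<close>
  have c: "fps_const (c / real \<sigma>) * fps_const (real \<sigma>) = fps_const c"
    using assms by simp
  show ?thesis
    unfolding fps_compose_deriv[OF X0] fps_exp_deriv fps_compose_mult_distrib[OF X0]
      fps_const_compose fps_deriv_power fps_deriv_fps_X c[symmetric]
    by (simp only: mult_ac mult_1_left mult_1_right)
qed

text \<open>Both halves of the theorem are instances, with \<open>c = 1\<close> and
  \<open>c = -1\<close>. The sum is the Cauchy product of the series for \<open>S\<close> with the
  exponential factor.\<close>

lemma A_change_at:
  assumes \<sigma>: "\<sigma> > 0"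
    and T: "cycle_fps T = cycle_fps S + fps_const c * fps_X ^ (\<sigma> - 1)"
  shows "real (A n T) = (\<Sum>i = 0..n div \<sigma>.
    fact n * c ^ i / (fact i * fact (n - \<sigma> * i) * real \<sigma> ^ i) * real (A (n - \<sigma> * i) S))"
proof -
  obtain F :: "real fps" where F0: "F $ 0 = 1" and F': "fps_deriv F = cycle_fps S * F"
    by (rule cycle_fps_egf_exists)
  define E where "E = fps_exp (c / real \<sigma>) oo fps_X ^ \<sigma>"
  have E_nth: "E $ j = (if \<sigma> dvd j then c ^ (j div \<sigma>) / (fact (j div \<sigma>) * real \<sigma> ^ (j div \<sigma>)) else 0)" for j
  proof -
    have "E $ j = (\<Sum>i=0..j. (c / real \<sigma>) ^ i / fact i * (if j = \<sigma> * i then 1 else 0))"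
      by (simp add: E_def fps_compose_nth fps_X_power_nth flip: power_mult)
    \<comment> \<open>The power \<open>x^(\<sigma> * i)\<close> meets coefficient \<open>j\<close>
      for at most one \<open>i\<close>, namely \<open>j div \<sigma>\<close>.\<close>
    also have "\<dots> = (\<Sum>i\<in>(if \<sigma> dvd j then {j div \<sigma>} else {}). (c / real \<sigma>) ^ i / fact i)"
      using \<sigma> by (intro sum.mono_neutral_cong_right) (auto split: if_splits)
    finally show ?thesis
      by (simp add: power_divide)
  qed
  \<comment> \<open>By the product rule the two logarithmic derivatives add up to
    \<open>cycle_fps T\<close>, so \<open>F * E\<close> is the generating function for
    \<open>T\<close>.\<close>
  have "fps_deriv (F * E) = cycle_fps T * (F * E)"
    using fps_deriv_exp_power[OF \<sigma>, of c] unfolding T by (simp add: F' E_def algebra_simps)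
  moreover have "(F * E) $ 0 = 1"
    by (simp add: F0 E_nth)
  ultimately have "real (A n T) = fact n * (E * F) $ n"
    by (subst A_eq_fps_nth) (simp_all add: mult.commute)
  also have "(E * F) $ n = (\<Sum>j=0..n. E $ j * F $ (n - j))"
    by (rule fps_mult_nth)
  \<comment> \<open>\<open>E\<close> has nonzero coefficients only at multiples of
    \<open>\<sigma>\<close>, which leaves the indices \<open>j = \<sigma> * i\<close>.\<close>
  also have "\<dots> = (\<Sum>j\<in>(\<lambda>i. \<sigma> * i) ` {0..n div \<sigma>}. E $ j * F $ (n - j))"
  proof (rule sum.mono_neutral_right)
    show "(\<lambda>i. \<sigma> * i) ` {0..n div \<sigma>} \<subseteq> {0..n}"
      using \<sigma> by (auto simp: less_eq_div_iff_mult_less_eq mult.commute)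
    show "\<forall>j\<in>{0..n} - (\<lambda>i. \<sigma> * i) ` {0..n div \<sigma>}. E $ j * F $ (n - j) = 0"
    proof
      fix j assume j: "j \<in> {0..n} - (\<lambda>i. \<sigma> * i) ` {0..n div \<sigma>}"
      have "\<not> \<sigma> dvd j"
      proof
        assume "\<sigma> dvd j"
        then have "j = \<sigma> * (j div \<sigma>)"
          by simp
        moreover have "j div \<sigma> \<in> {0..n div \<sigma>}"
          using j by (simp add: div_le_mono)
        ultimately show False
          using j by blast
      qed
      then show "E $ j * F $ (n - j) = 0"
        by (simp add: E_nth)
    qed
  qed simp
  also have "\<dots> = (\<Sum>i=0..n div \<sigma>. E $ (\<sigma> * i) * F $ (n - \<sigma> * i))"
    using \<sigma> by (subst sum.reindex) (auto simp: inj_on_def)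
  also have "fact n * \<dots> = (\<Sum>i = 0..n div \<sigma>.
    fact n * c ^ i / (fact i * fact (n - \<sigma> * i) * real \<sigma> ^ i) * real (A (n - \<sigma> * i) S))"
    unfolding sum_distrib_left A_eq_fps_nth[OF F0 F'] using \<sigma>
    by (intro sum.cong refl) (simp add: E_nth field_simps)
  finally show ?thesis .
qed

theorem theorem7:
  fixes S :: "nat set" and \<sigma> n :: nat
  assumes "S \<noteq> {}" and "\<forall>s\<in>S. s > 0" and "\<sigma> > 0"
  shows "(\<sigma> \<notin> S \<longrightarrow>
            real (A n (S \<union> {\<sigma>})) =
              (\<Sum>i = 0..n div \<sigma>. fact n / (fact i * fact (n - \<sigma> * i) * real \<sigma> ^ i)
                 * real (A (n - \<sigma> * i) S)))
       \<and> (\<sigma> \<in> S \<longrightarrow>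
            real (A n (S - {\<sigma>})) =
              (\<Sum>i = 0..n div \<sigma>. fact n * (-1) ^ i / (fact i * fact (n - \<sigma> * i) * real \<sigma> ^ i)
                 * real (A (n - \<sigma> * i) S)))"
proof (intro conjI impI)
  assume "\<sigma> \<notin> S"
  \<comment> \<open>Only the coefficient at \<open>\<sigma> - 1\<close> changes, from 0 to 1; the
    removal below changes it from 1 to 0.\<close>
  then have "cycle_fps (S \<union> {\<sigma>}) = cycle_fps S + fps_const 1 * fps_X ^ (\<sigma> - 1)"
    using \<open>\<sigma> > 0\<close> by (auto simp: fps_eq_iff cycle_fps_def fps_X_power_iff)
  from A_change_at[OF \<open>\<sigma> > 0\<close> this, of n]
  show "real (A n (S \<union> {\<sigma>})) = (\<Sum>i = 0..n div \<sigma>. fact n / (fact i * fact (n - \<sigma> * i) * real \<sigma> ^ i)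
      * real (A (n - \<sigma> * i) S))"
    by simp
next
  assume "\<sigma> \<in> S"
  then have "cycle_fps (S - {\<sigma>}) = cycle_fps S + fps_const (-1) * fps_X ^ (\<sigma> - 1)"
    using \<open>\<sigma> > 0\<close> by (auto simp: fps_eq_iff cycle_fps_def fps_X_power_iff)
  from A_change_at[OF \<open>\<sigma> > 0\<close> this, of n]
  show "real (A n (S - {\<sigma>})) = (\<Sum>i = 0..n div \<sigma>. fact n * (-1) ^ i / (fact i * fact (n - \<sigma> * i) * real \<sigma> ^ i)
      * real (A (n - \<sigma> * i) S))" .
qed

end
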